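(* For every integer $n\ge 1$, the number $$R_n=2^{\binom{n-1}{2}}\,(2n)!\;F(2^{-n})\prod_{m=1}^{\lfloor n/2\rfloor}(2^{2m}-1)$$ is a natural number.
   Context: The Rvachev function $\operatorname{up}:\mathbb{R}\to\mathbb{R}$ is the infinitely differentiable function with compact support $[-1,1]$ satisfying $\operatorname{up}(0)=1$ and $\operatorname{up}'(x)=2\bigl(\operatorname{up}(2x+1)-\operatorname{up}(2x-1)\bigr)$ for all $x\in\mathbb{R}$; equivalently $\operatorname{up}(x)=\int_{\mathbb{R}}\widehat{\operatorname{up}}(t)e^{2\pi i t x}\,dt$ with $\widehat{\operatorname{up}}(z)=\prod_{n=0}^\infty \frac{\sin(\pi z/2^n)}{\pi z/2^n}$. The Fabius function is $F(x)=\sum_{n=0}^\infty(-1)^{w(n)}\operatorname{up}(x-2n-1)$ for $x\in\mathbb{R}$, where $w(n)$ is the sum of the binary digits of $n$. In particular $F(x)=\operatorname{up}(x-1)$ for $0\le x\le 2$, $F(x)=0$ for $x<0$, and $F'(x)=2F(2x)$ for all $x\in\mathbb{R}$. Empty products equal $1$. *)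

theory Defs
  imports "HOL-Analysis.Analysis"
begin

definition smooth :: "(real \<Rightarrow> real) \<Rightarrow> bool" where
  "smooth f \<longleftrightarrow> (\<forall>k x. (deriv ^^ k) f differentiable (at x))"

definition is_rvachev :: "(real \<Rightarrow> real) \<Rightarrow> bool" where
  "is_rvachev u \<longleftrightarrow>
     smooth u \<and>
     closure {x. u x \<noteq> 0} = {-1..1} \<and>
     u 0 = 1 \<and>
     (\<forall>x. (u has_real_derivative 2 * (u (2 * x + 1) - u (2 * x - 1))) (at x))"

(* Exactly one function satisfies is_rvachev: it is the inverse Fourier transform of the
   product over n >= 0 of sin (pi z / 2^n) / (pi z / 2^n). *)
definition up :: "real \<Rightarrow> real" where
  "up = (THE u. is_rvachev u)"

fun binary_digit_sum :: "nat \<Rightarrow> nat" where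
  "binary_digit_sum n = (if n = 0 then 0 else n mod 2 + binary_digit_sum (n div 2))"

(* The recursion equation is unconditional and would loop as a rewrite rule. *)
declare binary_digit_sum.simps [simp del]

(* Since up vanishes outside the interval [-1,1], at every x at most one term is nonzero. *)
definition fabius :: "real \<Rightarrow> real" where
  "fabius x = (\<Sum>n. (-1) ^ binary_digit_sum n * up (x - 2 * real n - 1))"

end

(*
  The function up is the unique fixed point of the refinement operator
  f |-> integral of f over [2x - 1, 2x + 1], which halves the sup distance of even profiles f
  supported in [-1,1] with f(x) + f(1 - x) = 1 on [0,1].  Uniqueness holds since the refinement
  equation determines all moments from the value at 0.

  Iterated partial integration gives F(2^-n) = d_n / (2^(n choose 2) n!) with
  d_n = 2^-n * (integral of (1 - s)^n up(s)), so R_n = 2 (2n-1)!! d_n prod_{m <= n/2} (4^m - 1).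
  The moments c_k of up satisfy
  (k + 1) (2^k - 1) c_k = sum over j < k with k - j even of (k+1 choose j) c_j,
  which bounds their denominators, and 2^n d_n = sum_k (n choose k) c_k, so 2^n R_n is an integer.
  At the prime 2 one uses 2 d_n = n c_{n-1} for odd n and
  (n + 1) (2^n - 1) d_n = sum_{k < n} (n+1 choose k) d_k for even n:
  both show that 2 d_n has an odd denominator.
*)
theory Submission
  imports Defs
begin

section \<open>Moments and the refinement equation\<close>

text \<open>The value at 0 is left open, so that the difference of two Rvachev functions is again of
  this kind.\<close>

definition refinement_solution :: "(real \<Rightarrow> real) \<Rightarrow> bool" where
  "refinement_solution w \<longleftrightarrow>
     (\<forall>x. (w has_real_derivative 2 * (w (2 * x + 1) - w (2 * x - 1))) (at x)) \<and>
     (\<forall>x. 1 \<le> \<bar>x\<bar> \<longrightarrow> w x = 0)"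

text \<open>The lower limit only has to be at most -3, so that the limits 2b - 1 with b in [-1,1] are
  covered; w vanishes below -1.\<close>

definition partial_moment :: "(real \<Rightarrow> real) \<Rightarrow> nat \<Rightarrow> real \<Rightarrow> real \<Rightarrow> real" where
  "partial_moment w n a b = integral {-3..b} (\<lambda>s. (a - s) ^ n * w s)"

text \<open>At \<open>a = 0\<close> this is c_n up to the sign (-1)^n, which is harmless because c_n
  vanishes for odd n; at \<open>a = 1\<close> it is 2^n d_n.\<close>

definition moment :: "(real \<Rightarrow> real) \<Rightarrow> nat \<Rightarrow> real \<Rightarrow> real" where
  "moment w n a = integral {-1..1} (\<lambda>s. (a - s) ^ n * w s)"

lemma refinement_solution_deriv:
  "refinement_solution w \<Longrightarrow> (w has_real_derivative 2 * (w (2 * x + 1) - w (2 * x - 1))) (at x)"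
  by (simp add: refinement_solution_def)

lemma refinement_solution_eq_0: "refinement_solution w \<Longrightarrow> 1 \<le> \<bar>x\<bar> \<Longrightarrow> w x = 0"
  by (simp add: refinement_solution_def)

lemma refinement_solution_continuous_on: "refinement_solution w \<Longrightarrow> continuous_on S w"
  by (meson DERIV_continuous_on has_field_derivative_at_within refinement_solution_deriv)

lemma partial_moment_has_derivative:
  assumes w: "refinement_solution w" and "-4 < x" and "x < 3"
  shows "(partial_moment w n a has_real_derivative (a - x) ^ n * w x) (at x)"
proof -
  have cont: "continuous_on A (\<lambda>s. (a - s) ^ n * w s)" for A
    by (intro continuous_intros refinement_solution_continuous_on[OF w])
  have zero: "((\<lambda>s. (a - s) ^ n * w s) has_integral 0) {c..d}" if "d \<le> -1" for c d
    by (rule has_integral_is_0) (use that in \<open>auto simp: refinement_solution_eq_0[OF w]\<close>)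
  \<comment> \<open>As \<open>w\<close> vanishes below -1, the lower limit may move from -3 to -5;
    this puts \<open>x\<close> in the interior of the interval of integration.\<close>
  have "partial_moment w n a y = integral {-5..y} (\<lambda>s. (a - s) ^ n * w s)" if "-5 < y" for y
  proof (cases "-3 \<le> y")
    case True
    have "integral {-5..-3} (\<lambda>s. (a - s) ^ n * w s) = 0"
      using zero[of "-3" "-5"] by (simp add: integral_unique)
    then show ?thesis
      using True Henstock_Kurzweil_Integration.integral_combine
          [where a="-5" and c="-3" and b=y and f="\<lambda>s. (a - s) ^ n * w s"] cont
      by (auto simp: partial_moment_def integrable_continuous_real)
  next
    case False
    then show ?thesis
      using zero[of y "-5"] zero[of y "-3"] by (simp add: partial_moment_def integral_unique)
  qed
  moreover have "((\<lambda>y. integral {-5..y} (\<lambda>s. (a - s) ^ n * w s)) has_real_derivative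
                  (a - x) ^ n * w x) (at x)"
  proof -
    have "at x within {-5..3} = at x"
      by (rule at_within_interior) (use assms in simp)
    then show ?thesis
      using integral_has_real_derivative[OF cont, of x "-5" 3] assms by simp
  qed
  ultimately show ?thesis
    using assms(2)
    by (intro has_field_derivative_transform_within_open[of _ _ x "{-5<..}" "partial_moment w n a"]) auto
qed

lemma partial_moment_eq_0:
  assumes w: "refinement_solution w" and "b \<le> -1"
  shows "partial_moment w n a b = 0"
  unfolding partial_moment_def
  by (rule integral_unique, rule has_integral_is_0) (use assms in \<open>auto simp: refinement_solution_eq_0[OF w]\<close>)

lemma partial_moment_eq_moment:
  assumes w: "refinement_solution w" and "1 \<le> b"
  shows "partial_moment w n a b = moment w n a"
proof -
  have int: "(\<lambda>s. (a - s) ^ n * w s) integrable_on {c..d}" for c d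
    by (intro integrable_continuous_real continuous_intros refinement_solution_continuous_on[OF w])
  have "integral {1..b} (\<lambda>s. (a - s) ^ n * w s) = 0"
    by (rule integral_unique, rule has_integral_is_0) (auto simp: refinement_solution_eq_0[OF w])
  moreover have "integral {-3..-1} (\<lambda>s. (a - s) ^ n * w s) = 0"
    by (rule integral_unique, rule has_integral_is_0) (auto simp: refinement_solution_eq_0[OF w])
  ultimately show ?thesis
    using Henstock_Kurzweil_Integration.integral_combine
        [where a="-3" and c="-1" and b=b and f="\<lambda>s. (a - s) ^ n * w s"]
      Henstock_Kurzweil_Integration.integral_combine
        [where a="-1" and c="1" and b=b and f="\<lambda>s. (a - s) ^ n * w s"] assms int
    by (simp add: partial_moment_def moment_def)
qed

lemma partial_moment_continuous_on:
  assumes w: "refinement_solution w" and c: "\<bar>c\<bar> \<le> 1"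
  shows "continuous_on {-1..1} (\<lambda>x. partial_moment w n a (2 * x + c))"
proof (rule continuous_on_compose2[where g = "partial_moment w n a" and t = "{-3..3}"])
  show "continuous_on {-3..3} (partial_moment w n a)"
    unfolding partial_moment_def
    by (intro indefinite_integral_continuous_1 integrable_continuous_real continuous_intros
        refinement_solution_continuous_on[OF w])
  show "continuous_on {-1..1} (\<lambda>x. 2 * x + c)"
    by (intro continuous_intros)
  show "(\<lambda>x. 2 * x + c) ` {-1..1} \<subseteq> {-3..3}"
    using c by auto
qed

text \<open>Integration by parts in rescaled form. Since (2a + c) - (2x + c) = 2(a - x), the
  refinement equation gives both sides the same derivative in \<open>b\<close>, and both vanish at
  \<open>b = -1\<close>.\<close>

lemma partial_moment_rec:
  assumes w: "refinement_solution w" and b: "-1 \<le> b" "b \<le> 1"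
  shows "(Suc n * partial_moment w n a b + (a - b) ^ Suc n * w b) * 2 ^ Suc n =
           partial_moment w (Suc n) (2 * a + 1) (2 * b + 1)
           - partial_moment w (Suc n) (2 * a - 1) (2 * b - 1)"
proof -
  define \<Phi> where "\<Phi> x = (Suc n * partial_moment w n a x + (a - x) ^ Suc n * w x) * 2 ^ Suc n
      - (partial_moment w (Suc n) (2 * a + 1) (2 * x + 1)
         - partial_moment w (Suc n) (2 * a - 1) (2 * x - 1))" for x
  have "(\<Phi> has_real_derivative 0) (at x)" if x: "-1 < x" "x < 1" for x
  proof -
    note pm = partial_moment_has_derivative[OF w]
    have d: "((\<lambda>x. partial_moment w (Suc n) (2 * a + c) (2 * x + c)) has_real_derivative
        (2 * a + c - (2 * x + c)) ^ Suc n * w (2 * x + c) * 2) (at x)" if "-4 < 2 * x + c" "2 * x + c < 3" for c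
      by (rule DERIV_chain2[where g = "\<lambda>x. 2 * x + c", OF pm]) (use that in \<open>auto intro!: derivative_eq_intros\<close>)
    have d1: "((\<lambda>x. partial_moment w (Suc n) (2 * a + 1) (2 * x + 1)) has_real_derivative
        (2 * (a - x)) ^ Suc n * w (2 * x + 1) * 2) (at x)"
      using d[of 1] x by (simp add: algebra_simps)
    have d2: "((\<lambda>x. partial_moment w (Suc n) (2 * a - 1) (2 * x - 1)) has_real_derivative
        (2 * (a - x)) ^ Suc n * w (2 * x - 1) * 2) (at x)"
      using d[of "-1"] x by (simp add: algebra_simps)
    have pow: "((\<lambda>x. (a - x) ^ Suc n) has_real_derivative - (real (Suc n) * (a - x) ^ n)) (at x)"
      by (rule DERIV_cong[OF DERIV_power[where f = "\<lambda>x. a - x" and D = "-1"]])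
        (auto intro!: derivative_eq_intros)
    have G: "(partial_moment w n a has_real_derivative (a - x) ^ n * w x) (at x)"
      using x by (intro pm) auto
    show ?thesis
      unfolding \<Phi>_def
      by (rule DERIV_cong[OF DERIV_diff[OF DERIV_cmult_right[OF DERIV_add[OF DERIV_cmult[OF G]
            DERIV_mult[OF pow refinement_solution_deriv[OF w]]]] DERIV_diff[OF d1 d2]]])
        (simp only: power_mult_distrib, simp add: algebra_simps)
  qed
  moreover have "continuous_on {-1..1} \<Phi>"
  proof -
    have "continuous_on {-3..1} (partial_moment w n a)"
      unfolding partial_moment_def
      by (intro indefinite_integral_continuous_1 integrable_continuous_real continuous_intros
          refinement_solution_continuous_on[OF w])
    then have G: "continuous_on {-1..1} (partial_moment w n a)"
      by (rule continuous_on_subset) auto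
    have "continuous_on {-1..1} (\<lambda>x. partial_moment w (Suc n) (2 * a - 1) (2 * x - 1))"
      using partial_moment_continuous_on[OF w, of "-1"] by simp
    then show ?thesis
      unfolding \<Phi>_def
      by (intro continuous_intros refinement_solution_continuous_on[OF w] G
          partial_moment_continuous_on[OF w]) simp_all
  qed
  ultimately have "\<Phi> b = \<Phi> (-1)"
    using b DERIV_isconst2[of "-1" 1 \<Phi> b] by simp
  moreover have "\<Phi> (-1) = 0"
    by (simp add: \<Phi>_def partial_moment_eq_0[OF w] refinement_solution_eq_0[OF w])
  ultimately show ?thesis by (simp add: \<Phi>_def)
qed

section \<open>Full moments: recursion, parity and sign\<close>

text \<open>At \<open>b = 1\<close> in \<open>partial_moment_rec\<close> the boundary term vanishes,
  and the upper limits 3 and 1 cover the whole support.\<close>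

lemma moment_rec:
  assumes w: "refinement_solution w"
  shows "real (Suc n) * 2 ^ Suc n * moment w n a
           = moment w (Suc n) (2 * a + 1) - moment w (Suc n) (2 * a - 1)"
proof -
  have "w 1 = 0" and "2 * 1 - 1 = (1::real)" and "1 \<le> 2 * 1 + (1::real)"
    using refinement_solution_eq_0[OF w, of 1] by simp_all
  with partial_moment_rec[OF w, of 1 n a] show ?thesis
    by (simp add: partial_moment_eq_moment[OF w] mult_ac)
qed

text \<open>Binomial expansion of ((a - s) + b)^n under the integral.\<close>

lemma moment_shift:
  fixes a b :: real
  assumes w: "refinement_solution w"
  shows "moment w n (a + b) = (\<Sum>k\<le>n. real (n choose k) * b ^ (n - k) * moment w k a)"
proof -
  have "(a + b - s) ^ n * w s = (\<Sum>k\<le>n. (real (n choose k) * b ^ (n - k)) * ((a - s) ^ k * w s))" for s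
    using binomial_ring[of "a - s" b n] by (simp add: sum_distrib_right sum_distrib_left algebra_simps)
  moreover have "(\<lambda>s. (a - s) ^ k * w s) integrable_on {-1..1}" for k
    by (intro integrable_continuous_real continuous_intros refinement_solution_continuous_on[OF w])
  ultimately show ?thesis
    by (simp add: moment_def integral_sum integrable_on_mult_right)
qed

text \<open>Left of 0 the term w(2x - 1) vanishes, so w'(x) = 2 w(2x + 1), which is also the
  derivative of the right side. The exponent 0 leaves \<open>a\<close> free; the dyadic evaluation
  sets it to the upper limit.\<close>

lemma refinement_solution_eq_partial_moment:
  assumes w: "refinement_solution w" and y: "-1 \<le> y" "y \<le> 0"
  shows "w y = partial_moment w 0 a (2 * y + 1)"
proof -
  define \<Phi> where "\<Phi> x = w x - partial_moment w 0 a (2 * x + 1)" for x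
  have "(\<Phi> has_real_derivative 0) (at x)" if x: "-1 < x" "x < 0" for x
  proof -
    have "((\<lambda>x. partial_moment w 0 a (2 * x + 1)) has_real_derivative
        (a - (2 * x + 1)) ^ 0 * w (2 * x + 1) * 2) (at x)"
      by (rule DERIV_chain2[OF partial_moment_has_derivative[OF w]])
        (use x in \<open>auto intro!: derivative_eq_intros\<close>)
    then show ?thesis
      unfolding \<Phi>_def
      using refinement_solution_eq_0[OF w, of "2 * x - 1"] x
      by (auto intro!: derivative_eq_intros refinement_solution_deriv[OF w])
  qed
  moreover have "continuous_on {-1..0} \<Phi>"
    unfolding \<Phi>_def
    by (intro continuous_intros refinement_solution_continuous_on[OF w]
        continuous_on_subset[OF partial_moment_continuous_on[OF w, of 1]]) auto
  ultimately have "\<Phi> y = \<Phi> (-1)"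
    using y DERIV_isconst2[of "-1" 0 \<Phi> y] by simp
  then show ?thesis
    by (simp add: \<Phi>_def partial_moment_eq_0[OF w] refinement_solution_eq_0[OF w])
qed

lemma moment_0_eq:
  assumes "refinement_solution w"
  shows "moment w 0 a = w 0"
proof -
  have "w 0 = partial_moment w 0 a 1"
    using refinement_solution_eq_partial_moment[OF assms, of 0 a] by simp
  also have "\<dots> = moment w 0 a"
    by (rule partial_moment_eq_moment[OF assms]) simp
  finally show ?thesis by simp
qed

text \<open>Expand \<open>moment_rec\<close> at \<open>a = 0\<close> around 0 with shifts 1 and -1.
  Terms with n - k odd cancel, among them k = n + 1; the term k = n moves to the left and turns
  2^(n+1) into 2(2^n - 1).\<close>

lemma moment_0_rec:
  assumes w: "refinement_solution w"
  shows "real (Suc n) * (2 ^ n - 1) * moment w n 0 =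
           (\<Sum>k<n. real (Suc n choose k) * of_bool (even (n - k)) * moment w k 0)"
proof -
  have "real (Suc n) * 2 ^ Suc n * moment w n 0 = moment w (Suc n) (0 + 1) - moment w (Suc n) (0 + (-1))"
    using moment_rec[OF w, of n 0] by simp
  also have "\<dots> = (\<Sum>k\<le>Suc n. real (Suc n choose k) * (1 - (-1) ^ (Suc n - k)) * moment w k 0)"
    unfolding moment_shift[OF w] by (simp add: algebra_simps flip: sum_subtractf)
  also have "\<dots> = (\<Sum>k<n. real (Suc n choose k) * (1 - (-1) ^ (Suc n - k)) * moment w k 0)
      + real (Suc n) * 2 * moment w n 0"
    by (simp add: lessThan_Suc_atMost[symmetric])
  also have "(\<Sum>k<n. real (Suc n choose k) * (1 - (-1) ^ (Suc n - k)) * moment w k 0) =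
      2 * (\<Sum>k<n. real (Suc n choose k) * of_bool (even (n - k)) * moment w k 0)"
    unfolding sum_distrib_left
    by (rule sum.cong) (auto simp: Suc_diff_le)
  finally show ?thesis by (simp add: algebra_simps)
qed

lemma moment_factor_pos: "0 < n \<Longrightarrow> 0 < real (Suc n) * (2 ^ n - 1)"
  by (intro mult_pos_pos) simp_all

text \<open>The recursion starts from the total mass, which equals \<open>w 0\<close>, and its
  leading coefficient is nonzero for n > 0.\<close>

lemma moment_vanishes:
  assumes w: "refinement_solution w" "w 0 = 0"
  shows "moment w n 0 = 0"
proof (induction n rule: less_induct)
  case (less n)
  show ?case
  proof (cases "n = 0")
    case True
    then show ?thesis using moment_0_eq[OF w(1)] w(2) by simp
  next
    case False
    have "real (Suc n) * (2 ^ n - 1) * moment w n 0 = 0"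
      unfolding moment_0_rec[OF w(1)] by (simp add: less)
    then show ?thesis
      by (metis False mult_eq_0_iff moment_factor_pos gr0I order_less_irrefl)
  qed
qed

text \<open>The recursion links only indices of equal parity, and for odd n it has no starting
  value.\<close>

lemma moment_0_odd:
  assumes w: "refinement_solution w" and "odd n"
  shows "moment w n 0 = 0"
  using \<open>odd n\<close>
proof (induction n rule: less_induct)
  case (less n)
  have "real (Suc n) * (2 ^ n - 1) * moment w n 0 = 0"
    unfolding moment_0_rec[OF w]
    by (intro sum.neutral ballI) (use less in auto)
  then show ?case
    by (metis less.prems odd_pos mult_eq_0_iff moment_factor_pos order_less_irrefl)
qed

text \<open>All coefficients of the recursion are nonnegative. This later gives the sign of R_n
  without any knowledge of the sign of \<open>w\<close>.\<close>

lemma moment_0_nonneg: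
  assumes w: "refinement_solution w" and "w 0 \<ge> 0"
  shows "moment w n 0 \<ge> 0"
proof (induction n rule: less_induct)
  case (less n)
  show ?case
  proof (cases "n = 0")
    case True
    then show ?thesis using moment_0_eq[OF w] assms(2) by simp
  next
    case False
    have "real (Suc n) * (2 ^ n - 1) * moment w n 0 \<ge> 0"
      unfolding moment_0_rec[OF w] by (intro sum_nonneg mult_nonneg_nonneg) (use less in auto)
    then show ?thesis
      by (metis False gr0I moment_factor_pos zero_le_mult_iff not_less)
  qed
qed

section \<open>Uniqueness through orthogonality to polynomials\<close>

text \<open>All moments of the difference of two solutions vanish, so it is orthogonal to all polynomials.\<close>

lemma refinement_solution_unique:
  assumes w: "refinement_solution w" "w 0 = 0"
  shows "w x = 0"
proof -
  note cont = refinement_solution_continuous_on[OF w(1)]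
  define J where "J = integral {-1..1} (\<lambda>s. w s * w s)"
  define K where "K = integral {-1..1} (\<lambda>s. \<bar>w s\<bar>)"
  have orth: "integral {-1..1} (\<lambda>s. (\<Sum>i\<le>n. a i * s ^ i) * w s) = 0" for a and n :: nat
  proof -
    have "((\<lambda>s. s ^ i * w s) has_integral 0) {-1..1}" for i
    proof -
      have "((\<lambda>s. (0 - s) ^ i * w s) has_integral moment w i 0) {-1..1}"
        unfolding moment_def
        by (intro integrable_integral integrable_continuous_real continuous_intros cont)
      then have "((\<lambda>s. (-1) ^ i * ((0 - s) ^ i * w s)) has_integral (-1) ^ i * 0) {-1..1}"
        using moment_vanishes[OF w] by (metis has_integral_mult_right)
      moreover have "(-1) ^ i * (- s) ^ i = s ^ i" for s :: real
        by (simp flip: power_mult_distrib)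
      ultimately show ?thesis by (simp flip: mult.assoc)
    qed
    then have "((\<lambda>s. \<Sum>i\<le>n. a i * (s ^ i * w s)) has_integral (\<Sum>i\<le>n. a i * 0)) {-1..1}"
      by (intro has_integral_sum has_integral_mult_right) auto
    then show ?thesis
      by (simp add: sum_distrib_right mult.assoc integral_unique)
  qed
  have J_le: "J \<le> e * K" if "e > 0" for e
  proof -
    obtain p where p: "real_polynomial_function p" "\<And>s. s \<in> {-1..1} \<Longrightarrow> \<bar>w s - p s\<bar> < e"
      by (rule Stone_Weierstrass_real_polynomial_function[OF compact_Icc[of "-1" 1] cont \<open>e > 0\<close>]) blast
    then obtain a n where a: "p = (\<lambda>s. \<Sum>i\<le>n. a i * s ^ i)"
      using real_polynomial_function_iff_sum by auto
    have p_cont: "continuous_on {-1..1} p"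
      unfolding a by (intro continuous_intros)
    \<comment> \<open>The polynomial \<open>p\<close> is orthogonal to \<open>w\<close>, so w^2 may
      be replaced by (w - p) w, which is at most e |w|.\<close>
    have "J = integral {-1..1} (\<lambda>s. w s * w s) - integral {-1..1} (\<lambda>s. p s * w s)"
      using orth by (simp add: J_def a)
    also have "\<dots> = integral {-1..1} (\<lambda>s. w s * w s - p s * w s)"
      by (intro Henstock_Kurzweil_Integration.integral_diff[symmetric] integrable_continuous_real
          continuous_intros cont p_cont)
    also have "\<dots> \<le> integral {-1..1} (\<lambda>s. e * \<bar>w s\<bar>)"
    proof (rule integral_le)
      fix s :: real
      assume "s \<in> {-1..1}"
      then have "\<bar>w s - p s\<bar> * \<bar>w s\<bar> \<le> e * \<bar>w s\<bar>"
        by (intro mult_right_mono) (use p in \<open>auto simp: less_imp_le\<close>)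
      then show "w s * w s - p s * w s \<le> e * \<bar>w s\<bar>"
        by (simp add: abs_le_iff flip: abs_mult left_diff_distrib)
    qed (intro integrable_continuous_real continuous_intros cont p_cont)+
    also have "\<dots> = e * K"
      by (simp add: K_def)
    finally show ?thesis .
  qed
  have K: "K \<ge> 0"
    unfolding K_def by (intro integral_nonneg integrable_continuous_real continuous_intros cont) auto
  have "J \<le> 0"
  proof (rule field_le_epsilon)
    fix e :: real
    assume "e > 0"
    \<comment> \<open>The added 1 keeps the divisor positive even if K = 0.\<close>
    then have "J \<le> e / (K + 1) * K"
      using K by (intro J_le) auto
    also have "\<dots> \<le> e"
      using K \<open>e > 0\<close> by (simp add: field_simps)
    finally show "J \<le> 0 + e" by simp
  qed
  moreover have "J \<ge> 0"
    unfolding J_def by (intro integral_nonneg integrable_continuous_real continuous_intros cont) auto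
  ultimately have "J = 0" by simp
  then have "\<forall>s\<in>{-1..1}. w s * w s = 0"
    unfolding J_def by (subst (asm) integral_eq_0_iff) (auto intro!: continuous_intros cont)
  then show ?thesis
    using refinement_solution_eq_0[OF w(1), of x] by (cases "x \<in> {-1..1}") auto
qed

section \<open>The numbers d_n and the values at dyadic points\<close>

text \<open>This is d_n, the integral of ((1 - s)/2)^n w(s). The scaling absorbs the powers of 2
  that a shift by 2 produces.\<close>

definition half_moment :: "(real \<Rightarrow> real) \<Rightarrow> nat \<Rightarrow> real" where
  "half_moment w n = moment w n 1 / 2 ^ n"

text \<open>In \<open>moment_rec\<close> at \<open>a = 1\<close> the points are 3 and 1, so the
  expansion is around 1 with shift 2. Its top term k = n + 1 cancels the moment at 1, and k = n
  moves to the left.\<close>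

lemma half_moment_rec:
  assumes w: "refinement_solution w"
  shows "real (Suc n) * (2 ^ n - 1) * half_moment w n =
           (\<Sum>k<n. real (Suc n choose k) * half_moment w k)"
proof -
  have "real (Suc n) * 2 ^ Suc n * moment w n 1 = moment w (Suc n) (1 + 2) - moment w (Suc n) 1"
    using moment_rec[OF w, of n 1] by simp
  also have "\<dots> = (\<Sum>k<Suc n. real (Suc n choose k) * 2 ^ (Suc n - k) * moment w k 1)"
    unfolding moment_shift[OF w, of _ 1 2] by (simp flip: lessThan_Suc_atMost)
  also have "\<dots> = 2 ^ Suc n * (\<Sum>k<Suc n. real (Suc n choose k) * half_moment w k)"
    unfolding sum_distrib_left
    by (rule sum.cong) (auto simp: half_moment_def power_diff field_simps)
  finally have "real (Suc n) * moment w n 1 = (\<Sum>k<Suc n. real (Suc n choose k) * half_moment w k)"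
    by simp
  then show ?thesis
    by (simp add: half_moment_def algebra_simps del: of_nat_Suc)
qed

lemma half_moment_odd:
  assumes w: "refinement_solution w" and "odd n"
  shows "2 * half_moment w n = n * moment w (n - 1) 0"
proof -
  obtain m where m: "n = Suc m" "even m"
    using \<open>odd n\<close> by (cases n) auto
  have "real (Suc m) * 2 ^ Suc m * moment w m 0
      = moment w (Suc m) (0 + 1) - moment w (Suc m) (0 + (-1))"
    using moment_rec[OF w, of m 0] by simp
  \<comment> \<open>Only even k contribute, since odd moments vanish; for these the exponent
    \<open>Suc m - k\<close> is odd because m is even.\<close>
  also have "moment w (Suc m) (0 + (-1)) = - moment w (Suc m) (0 + 1)"
    unfolding moment_shift[OF w] sum_negf[symmetric]
  proof (rule sum.cong)
    fix k
    assume "k \<in> {..Suc m}"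
    then show "real (Suc m choose k) * (-1) ^ (Suc m - k) * moment w k 0
        = - (real (Suc m choose k) * 1 ^ (Suc m - k) * moment w k 0)"
      using moment_0_odd[OF w, of k] m(2) by (cases "even k") auto
  qed simp
  finally show ?thesis
    by (simp add: half_moment_def m field_simps del: of_nat_Suc)
qed

lemma moment_1_eq_sum:
  assumes w: "refinement_solution w"
  shows "moment w n 1 = (\<Sum>k\<le>n. real (n choose k) * moment w k 0)"
  using moment_shift[OF w, of n 0 1] by simp

text \<open>With \<open>a = b\<close> the boundary term of \<open>partial_moment_rec\<close> drops
  out, and 2y - 1 lies left of the support. The surviving term is again diagonal, so the step can be
  iterated.\<close>

lemma partial_moment_diagonal:
  assumes w: "refinement_solution w" and y: "-1 \<le> y" "y \<le> 0"
  shows "partial_moment w n y y =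
           partial_moment w (Suc n) (2 * y + 1) (2 * y + 1) / (real (Suc n) * 2 ^ Suc n)"
proof -
  have "partial_moment w (Suc n) (2 * y - 1) (2 * y - 1) = 0"
    by (rule partial_moment_eq_0[OF w]) (use y in simp)
  then show ?thesis
    using partial_moment_rec[OF w y(1), of n y] y by (simp add: field_simps del: of_nat_Suc)
qed

text \<open>The map y -> 2y + 1 sends 2^j/2^n - 1 to 2^(j+1)/2^n - 1. Iterating the diagonal step
  reaches the upper limit 1, hence the full moment, and each step contributes a factor (j+1) 2^(j+1)
  to the denominator.\<close>

lemma refinement_solution_dyadic:
  assumes w: "refinement_solution w"
  shows "w (1 / 2 ^ n - 1) = half_moment w n / (2 ^ (n choose 2) * fact n)"
proof -
  have "w (1 / 2 ^ n - 1) =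
      partial_moment w j (2 ^ Suc j / 2 ^ n - 1) (2 ^ Suc j / 2 ^ n - 1) / (2 ^ (Suc j choose 2) * fact j)"
    if "j \<le> n" for j
    using that
  proof (induction j)
    case 0
    have "w (1 / 2 ^ n - 1) = partial_moment w 0 (2 / 2 ^ n - 1) (2 * (1 / 2 ^ n - 1) + 1)"
      by (rule refinement_solution_eq_partial_moment[OF w]) simp_all
    then show ?case
      by (simp add: algebra_simps choose_two)
  next
    case (Suc j)
    have "(2::real) ^ Suc j \<le> 2 ^ n"
      using Suc.prems by (intro power_increasing) auto
    then have "partial_moment w j (2 ^ Suc j / 2 ^ n - 1) (2 ^ Suc j / 2 ^ n - 1) =
        partial_moment w (Suc j) (2 * (2 ^ Suc j / 2 ^ n - 1) + 1) (2 * (2 ^ Suc j / 2 ^ n - 1) + 1)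
          / (real (Suc j) * 2 ^ Suc j)"
      by (intro partial_moment_diagonal[OF w]) (auto simp: field_simps)
    moreover have "2 * (2 ^ Suc j / 2 ^ n - 1) + 1 = 2 ^ Suc (Suc j) / 2 ^ n - (1::real)"
      by simp
    moreover have "(Suc (Suc j) choose 2) = (Suc j choose 2) + Suc j"
      by (simp add: numeral_2_eq_2)
    ultimately show ?case
      using Suc by (simp only: power_add fact_Suc of_nat_mult Suc_leD times_divide_eq_left divide_divide_eq_left mult_ac)
  qed
  from this[of n] have "w (1 / 2 ^ n - 1) = moment w n 1 / (2 ^ (Suc n choose 2) * fact n)"
    by (simp add: partial_moment_eq_moment[OF w])
  also have "(Suc n choose 2) = (n choose 2) + n"
    by (simp add: numeral_2_eq_2)
  finally show ?thesis
    by (simp add: half_moment_def power_add)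
qed

section \<open>Denominators of the moments\<close>

text \<open>Membership in the localization of the integers at the prime 2.\<close>

definition odd_denominator :: "real \<Rightarrow> bool" where
  "odd_denominator x \<longleftrightarrow> (\<exists>q :: int. odd q \<and> of_int q * x \<in> \<int>)"

lemma odd_denominatorI: "odd q \<Longrightarrow> of_int q * x \<in> \<int> \<Longrightarrow> odd_denominator x"
  unfolding odd_denominator_def by blast

lemma odd_denominator_Ints: "x \<in> \<int> \<Longrightarrow> odd_denominator x"
  using odd_denominatorI[of 1 x] by simp

lemma odd_denominator_add:
  assumes "odd_denominator x" "odd_denominator y"
  shows "odd_denominator (x + y)"
proof -
  from assms obtain p q :: int where "odd p" "of_int p * x \<in> \<int>" "odd q" "of_int q * y \<in> \<int>"
    unfolding odd_denominator_def by blast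
  then have "of_int q * (of_int p * x) + of_int p * (of_int q * y) \<in> \<int>"
    by (simp add: Ints_add Ints_mult)
  with \<open>odd p\<close> \<open>odd q\<close> show ?thesis
    by (intro odd_denominatorI[of "p * q"]) (auto simp: algebra_simps)
qed

lemma odd_denominator_sum: "(\<And>k. k \<in> A \<Longrightarrow> odd_denominator (f k)) \<Longrightarrow> odd_denominator (sum f A)"
  by (induction A rule: infinite_finite_induct)
    (auto intro: odd_denominator_add odd_denominator_Ints)

lemma odd_denominator_mult_Ints:
  assumes "x \<in> \<int>" "odd_denominator y"
  shows "odd_denominator (x * y)"
proof -
  from assms obtain q :: int where q: "odd q" "of_int q * y \<in> \<int>"
    unfolding odd_denominator_def by blast
  then have "x * (of_int q * y) \<in> \<int>"
    using assms(1) by (simp add: Ints_mult)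
  with q show ?thesis
    by (intro odd_denominatorI[of q]) (auto simp: mult_ac)
qed

lemma odd_denominator_cancel:
  assumes "odd p" "odd_denominator (of_int p * x)"
  shows "odd_denominator x"
proof -
  from assms(2) obtain q :: int where "odd q" "of_int q * (of_int p * x) \<in> \<int>"
    unfolding odd_denominator_def by blast
  with assms(1) show ?thesis
    by (intro odd_denominatorI[of "q * p"]) (auto simp: mult_ac)
qed

text \<open>Bezout for 2^n and an odd q writes x as an integer combination of 2^n x and q x.\<close>

lemma odd_denominator_imp_Ints:
  assumes "odd_denominator x" "2 ^ n * x \<in> \<int>"
  shows "x \<in> \<int>"
proof -
  from assms obtain q :: int where q: "odd q" "of_int q * x \<in> \<int>"
    unfolding odd_denominator_def by blast
  have "coprime (2 ^ n) q"
    using \<open>odd q\<close> by simp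
  then obtain a b where ab: "a * 2 ^ n + b * q = 1"
    using bezout_int[of "2 ^ n" q] by (metis coprime_imp_gcd_eq_1)
  have "x = of_int (a * 2 ^ n + b * q) * x"
    by (simp add: ab)
  also have "\<dots> = of_int a * (2 ^ n * x) + of_int b * (of_int q * x)"
    by (simp add: algebra_simps)
  also have "\<dots> \<in> \<int>"
    by (intro Ints_add Ints_mult Ints_of_int assms q)
  finally show ?thesis .
qed

text \<open>The product of the leading coefficients (k + 1)(2^k - 1) of the moment recursion over
  positive even k = 2i up to n; the odd moments vanish and contribute nothing.\<close>

definition moment_denominator :: "nat \<Rightarrow> nat" where
  "moment_denominator n = (\<Prod>i = 1..n div 2. (2 * i + 1) * (2 ^ (2 * i) - 1))"

lemma moment_denominator_dvd: "k \<le> n \<Longrightarrow> moment_denominator k dvd moment_denominator n"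
  unfolding moment_denominator_def
  by (intro prod_dvd_prod_subset) (auto intro: div_le_mono)

lemma odd_moment_denominator: "odd (moment_denominator n)"
  unfolding moment_denominator_def by (subst even_prod_iff) auto

lemma Ints_dvd_mult:
  assumes "real a * x \<in> \<int>" "a dvd b"
  shows "real b * x \<in> \<int>"
proof -
  obtain c where "b = a * c"
    using assms(2) by (rule dvdE)
  then have "real b * x = real c * (real a * x)"
    by simp
  then show ?thesis
    using assms(1) by (simp only: Ints_mult Ints_of_nat)
qed

lemma moment_denominator_mult_moment:
  assumes w: "refinement_solution w" and "w 0 = 1"
  shows "real (moment_denominator n) * moment w n 0 \<in> \<int>"
proof (induction n rule: less_induct)
  case (less n)
  consider "n = 0" | "odd n" | "n > 0" "even n"
    by blast
  then show ?case
  proof cases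
    case 1
    then show ?thesis
      using moment_0_eq[OF w, of 0] assms(2) by (simp add: moment_denominator_def)
  next
    case 2
    then show ?thesis
      using moment_0_odd[OF w] by simp
  next
    case 3
    obtain m where m: "n = Suc (Suc m)" "even m"
      using 3 by (cases n; cases "n - 1") auto
    then have div: "n div 2 = Suc (m div 2)" "2 * Suc (m div 2) = n"
      by auto
    have "moment_denominator n =
        moment_denominator m * ((2 * Suc (m div 2) + 1) * (2 ^ (2 * Suc (m div 2)) - 1))"
      unfolding moment_denominator_def div(1)
      by (subst prod.nat_ivl_Suc') (simp, rule mult.commute)
    then have "real (moment_denominator n) = real (moment_denominator m) * (real (Suc n) * real (2 ^ n - 1))"
      unfolding div(2) by (simp only: of_nat_mult Suc_eq_plus1)
    also have "real (2 ^ n - 1) = 2 ^ n - 1"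
      by (subst of_nat_diff) simp_all
    finally have "real (moment_denominator n) * moment w n 0
        = real (moment_denominator m) * (real (Suc n) * (2 ^ n - 1) * moment w n 0)"
      by (simp only: mult.assoc)
    also have "\<dots> = (\<Sum>k<n. real (Suc n choose k) * of_bool (even (n - k)) *
        (real (moment_denominator m) * moment w k 0))"
      unfolding moment_0_rec[OF w] sum_distrib_left by (simp add: mult_ac)
    also have "\<dots> \<in> \<int>"
    proof (rule Ints_sum)
      fix k
      assume "k \<in> {..<n}"
      \<comment> \<open>The index k = n - 1 is odd and its moment vanishes; every smaller k has a
        denominator dividing that of m = n - 2.\<close>
      then have "k = Suc m \<or> k \<le> m" using m by auto
      then have "real (moment_denominator m) * moment w k 0 \<in> \<int>"
      proof
        assume "k = Suc m"
        then show ?thesis using moment_0_odd[OF w, of k] m by simp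
      next
        assume "k \<le> m"
        then show ?thesis
          using less[of k] m by (auto intro: Ints_dvd_mult moment_denominator_dvd)
      qed
      then show "real (Suc n choose k) * of_bool (even (n - k)) *
          (real (moment_denominator m) * moment w k 0) \<in> \<int>"
        by (rule Ints_mult[rotated]) simp
    qed
    finally show ?thesis .
  qed
qed

text \<open>For even n the coefficient (n + 1)(2^n - 1) is odd and can be cancelled from the
  recursion. For odd n it is even, so the link to c_(n-1) takes over; the factor 2 comes from there,
  as d_1 = 1/2 shows.\<close>

lemma odd_denominator_half_moment:
  assumes w: "refinement_solution w" and "w 0 = 1"
  shows "odd_denominator (2 * half_moment w n)"
proof (induction n rule: less_induct)
  case (less n)
  consider "n = 0" | "odd n" | "n > 0" "even n"
    by blast
  then show ?case
  proof cases
    case 1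
    then show ?thesis
      using moment_0_eq[OF w, of 1] assms(2) by (simp add: half_moment_def odd_denominator_Ints)
  next
    case 2
    have "odd_denominator (moment w (n - 1) 0)"
      using moment_denominator_mult_moment[OF assms, of "n - 1"] odd_moment_denominator[of "n - 1"]
      by (intro odd_denominatorI[of "int (moment_denominator (n - 1))"]) simp_all
    then show ?thesis
      unfolding half_moment_odd[OF w 2] by (intro odd_denominator_mult_Ints) simp_all
  next
    case 3
    have "(\<Sum>k<n. real (Suc n choose k) * (2 * half_moment w k))
        = 2 * (\<Sum>k<n. real (Suc n choose k) * half_moment w k)"
      by (simp add: sum_distrib_left mult_ac)
    also have "\<dots> = of_int (int (Suc n) * (2 ^ n - 1)) * (2 * half_moment w n)"
      unfolding half_moment_rec[OF w, symmetric] by (simp add: mult_ac)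
    finally have eq: "(\<Sum>k<n. real (Suc n choose k) * (2 * half_moment w k))
        = of_int (int (Suc n) * (2 ^ n - 1)) * (2 * half_moment w n)" .
    have "odd_denominator (\<Sum>k<n. real (Suc n choose k) * (2 * half_moment w k))"
      by (intro odd_denominator_sum odd_denominator_mult_Ints less) auto
    then show ?thesis
      unfolding eq by (rule odd_denominator_cancel[rotated]) (use 3 in simp)
  qed
qed

section \<open>Integrality of R_n\<close>

text \<open>The even factors give 2^n n!, which cancels against the dyadic value; the odd factors
  (2n-1)!! remain to clear denominators.\<close>

lemma fact_double_eq: "fact (2 * n) = 2 ^ n * fact n * (\<Prod>i<n. 2 * i + 1 :: nat)"
proof (induction n)
  case (Suc n)
  have "fact (2 * Suc n) = 2 * Suc n * (2 * n + 1) * (fact (2 * n) :: nat)"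
    by (simp add: algebra_simps)
  then show ?case
    unfolding Suc.IH by (simp only: power_Suc fact_Suc prod.lessThan_Suc mult_ac of_nat_id)
qed simp

lemma refinement_solution_dyadic_Nats:
  assumes w: "refinement_solution w" and "w 0 = 1" and "n \<ge> 1"
  shows "2 ^ ((n - 1) choose 2) * fact (2 * n) * w (1 / 2 ^ n - 1)
           * (\<Prod>m = 1..n div 2. 2 ^ (2 * m) - 1) \<in> \<nat>"
    (is "?R \<in> \<nat>")
proof -
  define P :: nat where "P = (\<Prod>m = 1..n div 2. 2 ^ (2 * m) - 1)"
  define D :: nat where "D = (\<Prod>i<n. 2 * i + 1)"
  have P: "(\<Prod>m = 1..n div 2. 2 ^ (2 * m) - 1) = real P"
    by (simp add: P_def of_nat_diff)
  \<comment> \<open>Against the 2^n from (2n)! this leaves exactly one factor 2, the one in 2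
    d_n.\<close>
  have choose: "n choose 2 = ((n - 1) choose 2) + (n - 1)"
    using assms(3) by (cases n) (simp_all add: numeral_2_eq_2)
  have "real (fact (2 * n)) = 2 ^ n * fact n * real D"
    unfolding fact_double_eq D_def[symmetric] by simp
  then have "fact (2 * n) = 2 ^ n * fact n * real D"
    by simp
  moreover have "(2::real) ^ n = 2 * 2 ^ (n - 1)"
    using assms(3) by (simp flip: power_Suc)
  ultimately have R: "?R = real (D * P) * (2 * half_moment w n)"
    unfolding P refinement_solution_dyadic[OF w] choose by (simp add: power_add)
  have "moment_denominator n dvd D * P"
  proof -
    \<comment> \<open>The factors 2i + 1 with i up to n div 2 all occur in (2n-1)!!, since n div 2 <
      n for positive n.\<close>
    have "(\<Prod>i = 1..n div 2. 2 * i + 1) dvd D"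
      unfolding D_def using assms(3) by (intro prod_dvd_prod_subset) auto
    then show ?thesis
      unfolding moment_denominator_def P_def prod.distrib by (rule mult_dvd_mono) simp
  qed
  then have int: "real (D * P) * moment w k 0 \<in> \<int>" if "k \<le> n" for k
    using Ints_dvd_mult[OF moment_denominator_mult_moment[OF w assms(2), of k]] that
    by (meson dvd_trans moment_denominator_dvd)
  have "2 ^ n * ?R = 2 * (real (D * P) * moment w n 1)"
    unfolding R half_moment_def by simp
  also have "\<dots> = 2 * (\<Sum>k\<le>n. real (n choose k) * (real (D * P) * moment w k 0))"
    unfolding moment_1_eq_sum[OF w] by (simp add: sum_distrib_left mult_ac)
  also have "\<dots> \<in> \<int>"
    by (rule Ints_mult, simp, rule Ints_sum, rule Ints_mult, simp, rule int) simp
  finally have "2 ^ n * ?R \<in> \<int>" .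
  moreover have "odd_denominator ?R"
    unfolding R by (intro odd_denominator_mult_Ints odd_denominator_half_moment[OF w assms(2)]) auto
  ultimately have "?R \<in> \<int>"
    by (rule odd_denominator_imp_Ints[rotated])
  moreover have "?R \<ge> 0"
    unfolding R half_moment_def moment_1_eq_sum[OF w]
    by (intro mult_nonneg_nonneg divide_nonneg_nonneg sum_nonneg moment_0_nonneg[OF w]) (use assms in auto)
  ultimately show ?thesis
    by (auto simp: Nats_altdef2)
qed

section \<open>Existence and uniqueness of the Rvachev function\<close>

lemma DERIV_imp_continuous_on:
  "(\<And>x. (f has_real_derivative f' x) (at x)) \<Longrightarrow> continuous_on S f"
  by (intro continuous_at_imp_continuous_on ballI DERIV_isCont)

section \<open>Symmetric profiles and the refinement operator\<close>

text \<open>Conditions kept both by the refinement operator and by limits. The relation f(x) + f(1 -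
  x) = 1 normalizes the integral to 1 and forces f(0) = 1.\<close>

definition symmetric_profile :: "(real \<Rightarrow> real) \<Rightarrow> bool" where
  "symmetric_profile f \<longleftrightarrow>
     (\<forall>x. f (- x) = f x) \<and> (\<forall>x. 1 \<le> \<bar>x\<bar> \<longrightarrow> f x = 0) \<and>
     (\<forall>x. 0 \<le> x \<and> x \<le> 1 \<longrightarrow> f x + f (1 - x) = 1) \<and> (\<forall>x. 0 \<le> f x)"

lemma
  assumes "symmetric_profile f"
  shows symmetric_profile_even: "f (- x) = f x"
    and symmetric_profile_eq_0: "1 \<le> \<bar>x\<bar> \<Longrightarrow> f x = 0"
    and symmetric_profile_add: "0 \<le> x \<Longrightarrow> x \<le> 1 \<Longrightarrow> f x + f (1 - x) = 1"
    and symmetric_profile_nonneg: "0 \<le> f x"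
  using assms by (auto simp: symmetric_profile_def)

lemma symmetric_profile_le_1:
  assumes f: "symmetric_profile f"
  shows "f x \<le> 1"
proof -
  have "f \<bar>x\<bar> \<le> 1"
  proof (cases "\<bar>x\<bar> \<le> 1")
    case True
    then show ?thesis
      using symmetric_profile_add[OF f, of "\<bar>x\<bar>"] symmetric_profile_nonneg[OF f, of "1 - \<bar>x\<bar>"] by simp
  next
    case False
    then show ?thesis using symmetric_profile_eq_0[OF f, of "\<bar>x\<bar>"] by simp
  qed
  then show ?thesis
    using symmetric_profile_even[OF f, of x] by (cases "0 \<le> x") auto
qed

text \<open>Evenness of \<open>f\<close> makes P - P(0) odd. The relation f(x) + f(1 - x) = 1 makes
  P(s) - P(1 - s) - s constant on [0,1], and comparing its ends gives P(1) = P(0) + 1/2.\<close>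

lemma
  assumes f: "symmetric_profile f" and P: "\<And>x. (P has_real_derivative f x) (at x)"
  shows antiderivative_profile_minus: "P (- x) = 2 * P 0 - P x"
    and antiderivative_profile_ge: "1 \<le> x \<Longrightarrow> P x = P 0 + 1 / 2"
    and antiderivative_profile_le: "x \<le> -1 \<Longrightarrow> P x = P 0 - 1 / 2"
proof -
  have minus: "P (- x) = 2 * P 0 - P x" for x
  proof -
    have "((\<lambda>x. P x + P (- x)) has_real_derivative f x + f (- x) * (-1)) (at x)" for x
      by (intro DERIV_add P DERIV_chain2[where g = uminus, OF P]) (auto intro!: derivative_eq_intros)
    then have "((\<lambda>x. P x + P (- x)) has_real_derivative 0) (at x)" for x
      by (simp add: symmetric_profile_even[OF f])
    then have "P x + P (- x) = P 0 + P (- 0)"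
      using DERIV_isconst_all[of "\<lambda>x. P x + P (- x)" x 0] by blast
    then show ?thesis by simp
  qed
  have ge: "P x = P 0 + 1 / 2" if "1 \<le> x" for x
  proof -
    have "P x = P 1"
    proof (cases "x = 1")
      case False
      with \<open>1 \<le> x\<close> have "1 < x" by simp
      then show ?thesis
      proof (rule DERIV_isconst_end)
        fix s :: real
        assume "1 < s" "s < x"
        then show "(P has_real_derivative 0) (at s)"
          using P[of s] symmetric_profile_eq_0[OF f, of s] by simp
      qed (rule DERIV_imp_continuous_on, rule P)
    qed simp
    moreover have "P 1 - P (1 - 1) - 1 = P 0 - P (1 - 0) - 0"
    proof (rule DERIV_isconst_end[where f = "\<lambda>s. P s - P (1 - s) - s"])
      have deriv: "((\<lambda>s. P s - P (1 - s) - s) has_real_derivative f s - f (1 - s) * (-1) - 1) (at s)" for s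
        by (intro DERIV_diff P DERIV_chain2[where g = "\<lambda>s. 1 - s", OF P])
          (auto intro!: derivative_eq_intros)
      then show "continuous_on {0..1} (\<lambda>s. P s - P (1 - s) - s)"
        by (rule DERIV_imp_continuous_on)
      show "((\<lambda>s. P s - P (1 - s) - s) has_real_derivative 0) (at s)" if "0 < s" "s < 1" for s
        using deriv[of s] symmetric_profile_add[OF f, of s] that by simp
    qed simp
    ultimately show ?thesis by simp
  qed
  show "P (- x) = 2 * P 0 - P x" by (rule minus)
  show "1 \<le> x \<Longrightarrow> P x = P 0 + 1 / 2" by (rule ge)
  show "x \<le> -1 \<Longrightarrow> P x = P 0 - 1 / 2"
    using ge[of "- x"] minus[of x] by simp
qed

lemma refine_has_derivative:
  assumes "\<And>x. (P has_real_derivative f x) (at x)"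
  shows "((\<lambda>x. P (2 * x + 1) - P (2 * x - 1)) has_real_derivative
           2 * (f (2 * x + 1) - f (2 * x - 1))) (at x)"
proof -
  have "((\<lambda>x. P (2 * x + 1) - P (2 * x - 1)) has_real_derivative
      f (2 * x + 1) * 2 - f (2 * x - 1) * 2) (at x)"
    by (intro DERIV_diff DERIV_chain2[where g = "\<lambda>x. 2 * x + 1", OF assms]
        DERIV_chain2[where g = "\<lambda>x. 2 * x - 1", OF assms]) (auto intro!: derivative_eq_intros)
  then show ?thesis by (simp add: algebra_simps)
qed

lemma symmetric_profile_refine:
  assumes f: "symmetric_profile f" and P: "\<And>x. (P has_real_derivative f x) (at x)"
  shows "symmetric_profile (\<lambda>x. P (2 * x + 1) - P (2 * x - 1))"
proof -
  note minus = antiderivative_profile_minus[OF f P]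
  note ge = antiderivative_profile_ge[OF f P]
  note le = antiderivative_profile_le[OF f P]
  have even: "P (2 * - x + 1) - P (2 * - x - 1) = P (2 * x + 1) - P (2 * x - 1)" for x
  proof -
    have "2 * - x + 1 = - (2 * x - 1)" "2 * - x - 1 = - (2 * x + 1)"
      by simp_all
    then show ?thesis by (simp only: minus)
  qed
  have zero: "P (2 * x + 1) - P (2 * x - 1) = 0" if "1 \<le> \<bar>x\<bar>" for x
  proof (cases "0 \<le> x")
    case True
    then show ?thesis using that ge[of "2 * x + 1"] ge[of "2 * x - 1"] by simp
  next
    case False
    then show ?thesis using that le[of "2 * x + 1"] le[of "2 * x - 1"] by simp
  qed
  have add: "P (2 * x + 1) - P (2 * x - 1) + (P (2 * (1 - x) + 1) - P (2 * (1 - x) - 1)) = 1"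
    if "0 \<le> x" "x \<le> 1" for x
  proof -
    have "2 * (1 - x) + 1 = - (2 * x - 3)" "2 * (1 - x) - 1 = - (2 * x - 1)"
      by simp_all
    then have "P (2 * (1 - x) + 1) - P (2 * (1 - x) - 1) = P (2 * x - 1) - P (2 * x - 3)"
      by (simp only: minus)
    \<comment> \<open>The sum telescopes to P(2x + 1) - P(2x - 3), whose points lie on opposite
      sides of the support.\<close>
    then show ?thesis
      using ge[of "2 * x + 1"] le[of "2 * x - 3"] that by simp
  qed
  have "P (2 * x - 1) \<le> P (2 * x + 1)" for x
    using P symmetric_profile_nonneg[OF f]
    by (intro DERIV_nonneg_imp_nondecreasing[of "2 * x - 1" "2 * x + 1" P]) auto
  then show ?thesis
    unfolding symmetric_profile_def using even zero add by simp
qed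

text \<open>The difference \<open>R\<close> of the antiderivatives, normalized at 0, is M-Lipschitz
  and vanishes at 0 and outside (-1,1). Every point is within 1/2 of a zero, so |R| is at most
  M/2.\<close>

lemma refine_contraction:
  assumes f: "symmetric_profile f" and P: "\<And>x. (P has_real_derivative f x) (at x)"
    and g: "symmetric_profile g" and Q: "\<And>x. (Q has_real_derivative g x) (at x)"
    and M: "\<And>x. \<bar>f x - g x\<bar> \<le> M"
  shows "\<bar>(P (2 * x + 1) - P (2 * x - 1)) - (Q (2 * x + 1) - Q (2 * x - 1))\<bar> \<le> M / 2"
proof -
  define R where "R y = (P y - P 0) - (Q y - Q 0)" for y
  have "(R has_real_derivative f y - g y) (at y)" for y
    unfolding R_def by (auto intro!: derivative_eq_intros P Q)
  then have lip: "\<bar>R y - R z\<bar> \<le> M * \<bar>y - z\<bar>" for y z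
    using field_differentiable_bound[of UNIV R "\<lambda>y. f y - g y" M y z] M by simp
  have out: "R y = 0" if "1 \<le> \<bar>y\<bar>" for y
  proof (cases "0 \<le> y")
    case True
    then show ?thesis
      using that antiderivative_profile_ge[OF f P, of y] antiderivative_profile_ge[OF g Q, of y]
      by (simp add: R_def)
  next
    case False
    then show ?thesis
      using that antiderivative_profile_le[OF f P, of y] antiderivative_profile_le[OF g Q, of y]
      by (simp add: R_def)
  qed
  have "0 \<le> M" using M[of 0] by simp
  have bound: "\<bar>R y\<bar> \<le> M / 2" for y
  proof -
    obtain z where z: "R z = 0" "\<bar>y - z\<bar> \<le> 1 / 2"
    proof (cases "1 \<le> \<bar>y\<bar>")
      case True
      then show thesis using that[of y] out by simp
    next
      case False
      have "R 0 = 0" "R 1 = 0" "R (-1) = 0"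
        using out by (simp_all add: R_def)
      moreover have "\<bar>y - 0\<bar> \<le> 1 / 2 \<or> \<bar>y - 1\<bar> \<le> 1 / 2 \<or> \<bar>y - (-1)\<bar> \<le> 1 / 2"
        using False by linarith
      ultimately show thesis using that by blast
    qed
    have "\<bar>R y\<bar> \<le> M * \<bar>y - z\<bar>"
      using lip[of y z] z by simp
    also have "\<dots> \<le> M * (1 / 2)"
      using z \<open>0 \<le> M\<close> by (intro mult_left_mono)
    finally show ?thesis by simp
  qed
  \<comment> \<open>One of the two points always lies outside (-1,1), so the bound M/2 is not
    doubled.\<close>
  have "R (2 * x + 1) = 0 \<or> R (2 * x - 1) = 0"
    using out[of "2 * x + 1"] out[of "2 * x - 1"] by linarith
  then have "\<bar>R (2 * x + 1) - R (2 * x - 1)\<bar> \<le> M / 2"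
    using bound[of "2 * x + 1"] bound[of "2 * x - 1"] by auto
  then show ?thesis by (simp add: R_def algebra_simps)
qed

section \<open>The fixed point of the refinement operator\<close>

lemma ex_antiderivative:
  fixes f :: "real \<Rightarrow> real"
  assumes "continuous_on UNIV f"
  shows "\<exists>P. \<forall>x. (P has_real_derivative f x) (at x)"
proof -
  have "isCont f x" for x
    using assms by (simp add: continuous_on_eq_continuous_at)
  then have "\<exists>P. \<forall>x. -\<infinity> < ereal x \<longrightarrow> ereal x < \<infinity> \<longrightarrow> (P has_vector_derivative f x) (at x)"
    by (intro einterval_antiderivative) simp_all
  then show ?thesis
    by (simp add: has_real_derivative_iff_has_vector_derivative)
qed

lemma symmetric_profile_bcontfun:
  assumes "symmetric_profile f" "continuous_on UNIV f"
  shows "f \<in> bcontfun"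
proof (rule bcontfun_normI)
  show "norm (f x) \<le> 1" for x
    using symmetric_profile_le_1[OF assms(1)] symmetric_profile_nonneg[OF assms(1)] by simp
qed fact

text \<open>Each condition is an equation or a weak inequality between finitely many values, so it
  passes to pointwise limits.\<close>

lemma complete_symmetric_profiles: "complete {b :: real \<Rightarrow>\<^sub>C real. symmetric_profile b}"
proof -
  have "symmetric_profile l"
    if b: "\<And>n. symmetric_profile (b n)" and lim: "b \<longlonglongrightarrow> l" for b :: "nat \<Rightarrow> real \<Rightarrow>\<^sub>C real" and l
  proof -
    have lim: "(\<lambda>n. b n x) \<longlonglongrightarrow> l x" for x
      using tendsto_uniform_limitI[OF tendsto_bcontfun_uniform_limit[OF lim]] by simp
    have "l (- x) = l x" for x
      using LIMSEQ_unique lim[of x] lim[of "- x"] by (simp add: symmetric_profile_even[OF b])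
    moreover have "l x = 0" if "1 \<le> \<bar>x\<bar>" for x
      using LIMSEQ_unique[OF lim[of x], of 0] that by (simp add: symmetric_profile_eq_0[OF b])
    moreover have "l x + l (1 - x) = 1" if "0 \<le> x" "x \<le> 1" for x
      using LIMSEQ_unique[OF tendsto_add[OF lim[of x] lim[of "1 - x"]], of 1] that
      by (simp add: symmetric_profile_add[OF b])
    moreover have "0 \<le> l x" for x
      using LIMSEQ_le_const[OF lim[of x], of 0] symmetric_profile_nonneg[OF b] by blast
    ultimately show ?thesis by (simp add: symmetric_profile_def)
  qed
  then show ?thesis
    unfolding complete_eq_closed closed_sequential_limits by blast
qed

text \<open>Banach's theorem on the continuous profiles. The antiderivative is kept in the
  conclusion because it makes the fixed point differentiable.\<close>

lemma ex_refinable_profile: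
  "\<exists>f P. symmetric_profile f \<and> (\<forall>x. (P has_real_derivative f x) (at x)) \<and>
     (\<lambda>x. P (2 * x + 1) - P (2 * x - 1)) = f"
proof -
  let ?S = "{b :: real \<Rightarrow>\<^sub>C real. symmetric_profile b}"
  have "\<forall>b\<in>?S. \<exists>c P. (\<forall>x. (P has_real_derivative apply_bcontfun b x) (at x)) \<and>
      (\<lambda>x. P (2 * x + 1) - P (2 * x - 1)) = apply_bcontfun c"
  proof
    fix b :: "real \<Rightarrow>\<^sub>C real"
    assume b: "b \<in> ?S"
    obtain P where P: "\<And>x. (P has_real_derivative b x) (at x)"
      using ex_antiderivative[of b] by auto
    have "continuous_on UNIV (\<lambda>x. P (2 * x + 1) - P (2 * x - 1))"
      by (rule DERIV_imp_continuous_on, rule refine_has_derivative, rule P)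
    moreover have "symmetric_profile (\<lambda>x. P (2 * x + 1) - P (2 * x - 1))"
      using b P by (intro symmetric_profile_refine) auto
    ultimately have "(\<lambda>x. P (2 * x + 1) - P (2 * x - 1)) \<in> bcontfun"
      by (intro symmetric_profile_bcontfun)
    then obtain c where "(\<lambda>x. P (2 * x + 1) - P (2 * x - 1)) = apply_bcontfun c"
      by (rule bcontfunE)
    with P show "\<exists>c P. (\<forall>x. (P has_real_derivative apply_bcontfun b x) (at x)) \<and>
        (\<lambda>x. P (2 * x + 1) - P (2 * x - 1)) = apply_bcontfun c"
      by blast
  qed
  from bchoice[OF this] obtain T where "\<forall>b\<in>?S. \<exists>P. (\<forall>x. (P has_real_derivative apply_bcontfun b x) (at x)) \<and>
      (\<lambda>x. P (2 * x + 1) - P (2 * x - 1)) = apply_bcontfun (T b)" ..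
  \<comment> \<open>\<open>P b\<close> is determined up to a constant, which cancels in the
    difference defining \<open>T b\<close>.\<close>
  from bchoice[OF this] obtain P where
    P: "\<And>b x. b \<in> ?S \<Longrightarrow> (P b has_real_derivative apply_bcontfun b x) (at x)"
    and T: "\<And>b. b \<in> ?S \<Longrightarrow> (\<lambda>x. P b (2 * x + 1) - P b (2 * x - 1)) = apply_bcontfun (T b)"
    by blast
  have "\<exists>!b\<in>?S. T b = b"
  proof (rule Banach_fix[where c = "1 / 2"])
    show "complete ?S" by (rule complete_symmetric_profiles)
    \<comment> \<open>The tent function witnesses that there are continuous profiles at all.\<close>
    have tent: "symmetric_profile (\<lambda>x. max 0 (1 - \<bar>x\<bar>))"
      by (auto simp: symmetric_profile_def)
    then have "(\<lambda>x::real. max 0 (1 - \<bar>x\<bar>)) \<in> bcontfun"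
      by (rule symmetric_profile_bcontfun) (intro continuous_intros)
    then obtain c where "(\<lambda>x::real. max 0 (1 - \<bar>x\<bar>)) = apply_bcontfun c"
      by (rule bcontfunE)
    with tent have "c \<in> ?S" by simp
    then show "?S \<noteq> {}" by blast
    show "T ` ?S \<subseteq> ?S"
    proof
      fix c
      assume "c \<in> T ` ?S"
      then obtain b where b: "b \<in> ?S" and c: "c = T b" by blast
      have "symmetric_profile (\<lambda>x. P b (2 * x + 1) - P b (2 * x - 1))"
        using b P[OF b] by (intro symmetric_profile_refine) auto
      then show "c \<in> ?S" by (simp add: T[OF b] c)
    qed
    fix b c
    assume b: "b \<in> ?S" and c: "c \<in> ?S"
    show "dist (T b) (T c) \<le> (1 / 2) * dist b c"
    proof (rule dist_bound)
      fix x
      have "\<bar>b y - c y\<bar> \<le> dist b c" for y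
        using dist_bounded[of b y c] by (simp add: dist_real_def)
      then have "\<bar>(P b (2 * x + 1) - P b (2 * x - 1)) - (P c (2 * x + 1) - P c (2 * x - 1))\<bar> \<le> dist b c / 2"
        using b c by (intro refine_contraction[where f = b and g = c] P) auto
      then show "dist (T b x) (T c x) \<le> (1 / 2) * dist b c"
        by (simp add: dist_real_def flip: T[OF b] T[OF c])
    qed
  qed auto
  then obtain b where b: "b \<in> ?S" "T b = b"
    by blast
  then show ?thesis
    using P[OF b(1)] T[OF b(1)] by (intro exI[of _ "apply_bcontfun b"] exI[of _ "P b"]) auto
qed

section \<open>Positivity and smoothness of the fixed point\<close>

text \<open>Needed for the support to be all of [-1,1]. Induction covers the intervals
  [-1 + 2^-n, 0]: left of -1/2 the map x -> 2x + 1 leads back to the previous interval, and from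
  -1/2 to 0 the function increases from 1/2.\<close>

lemma symmetric_profile_pos:
  assumes f: "symmetric_profile f" and w: "refinement_solution f" and "\<bar>x\<bar> < 1"
  shows "0 < f x"
proof -
  have pos: "0 < f x" if "-1 + 1 / 2 ^ n \<le> x" "x \<le> 0" for x and n :: nat
    using that
  proof (induction n arbitrary: x)
    case 0
    have "f 0 = 1"
      using symmetric_profile_add[OF f, of 0] symmetric_profile_eq_0[OF f, of 1] by simp
    then show ?case using 0 by simp
  next
    case (Suc n)
    show ?case
    proof (cases "x < -1/2")
      case True
      have "0 < f (2 * x + 1)"
        by (rule Suc.IH) (use Suc.prems True in \<open>auto simp: field_simps\<close>)
      moreover have "f (2 * x - 1) = 0"
        by (rule symmetric_profile_eq_0[OF f]) (use True in simp)
      \<comment> \<open>A zero of the nonnegative \<open>f\<close> is a minimum, so the derivative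
        would vanish there, against f(2x + 1) > 0.\<close>
      moreover have "2 * (f (2 * x + 1) - f (2 * x - 1)) = 0" if "f x = 0"
        using that symmetric_profile_nonneg[OF f]
        by (intro DERIV_local_min[OF refinement_solution_deriv[OF w], of 1 x]) auto
      ultimately have "f x \<noteq> 0" by auto
      then show ?thesis
        using symmetric_profile_nonneg[OF f, of x] by simp
    next
      case False
      have "f (- (1 / 2)) \<le> f x"
      proof (rule DERIV_nonneg_imp_nondecreasing[where f = f])
        fix s :: real
        assume "- (1 / 2) \<le> s" "s \<le> x"
        then have "f (2 * s - 1) = 0"
          using Suc.prems by (intro symmetric_profile_eq_0[OF f]) simp
        then show "\<exists>y. (f has_real_derivative y) (at s) \<and> 0 \<le> y"
          using refinement_solution_deriv[OF w, of s] symmetric_profile_nonneg[OF f, of "2 * s + 1"]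
          by auto
      qed (use False in simp)
      moreover have "f (- (1 / 2)) = 1 / 2"
        using symmetric_profile_add[OF f, of "1 / 2"] symmetric_profile_even[OF f, of "1 / 2"] by simp
      ultimately show ?thesis by simp
    qed
  qed
  obtain n :: nat where "(1 / 2) ^ n < 1 - \<bar>x\<bar>"
    using real_arch_pow_inv[of "1 - \<bar>x\<bar>" "1 / 2"] assms(3) by auto
  then have "0 < f (- \<bar>x\<bar>)"
    by (intro pos[of n]) (auto simp: power_one_over)
  then show ?thesis
    using symmetric_profile_even[OF f, of x] by (cases "0 \<le> x") auto
qed

text \<open>A class closed under differentiation: the derivative of f(ax + b) is 2a (f(2ax + 2b + 1)
  - f(2ax + 2b - 1)). Hence all iterated derivatives of \<open>f\<close> stay inside it.\<close>

inductive_set affine_combinations :: "(real \<Rightarrow> real) \<Rightarrow> (real \<Rightarrow> real) set"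
  for f :: "real \<Rightarrow> real" where
  base: "(\<lambda>x. f (a * x + b)) \<in> affine_combinations f"
| scale: "g \<in> affine_combinations f \<Longrightarrow> (\<lambda>x. c * g x) \<in> affine_combinations f"
| diff: "g \<in> affine_combinations f \<Longrightarrow> h \<in> affine_combinations f \<Longrightarrow>
    (\<lambda>x. g x - h x) \<in> affine_combinations f"

lemma refinement_solution_smooth:
  assumes w: "refinement_solution f"
  shows "smooth f"
proof -
  have deriv: "\<exists>h \<in> affine_combinations f. \<forall>x. (g has_real_derivative h x) (at x)"
    if "g \<in> affine_combinations f" for g
    using that
  proof induction
    case (base a b)
    have d: "((\<lambda>x. f (a * x + b)) has_real_derivative
        (2 * a) * (f ((2 * a) * x + (2 * b + 1)) - f ((2 * a) * x + (2 * b - 1)))) (at x)" for x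
    proof -
      have "((\<lambda>x. f (a * x + b)) has_real_derivative
          2 * (f (2 * (a * x + b) + 1) - f (2 * (a * x + b) - 1)) * a) (at x)"
        by (rule DERIV_chain2[where g = "\<lambda>x. a * x + b", OF refinement_solution_deriv[OF w]])
          (auto intro!: derivative_eq_intros)
      then show ?thesis by (simp add: algebra_simps)
    qed
    have m: "(\<lambda>x. (2 * a) * (f ((2 * a) * x + (2 * b + 1)) - f ((2 * a) * x + (2 * b - 1))))
        \<in> affine_combinations f"
      by (intro affine_combinations.intros)
    show ?case
      by (rule bexI[OF _ m]) (use d in blast)
  next
    case (scale g c)
    then obtain h where "h \<in> affine_combinations f" "\<forall>x. (g has_real_derivative h x) (at x)"
      by blast
    then show ?case
      by (intro bexI[of _ "\<lambda>x. c * h x"]) (auto intro: affine_combinations.intros DERIV_cmult)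
  next
    case (diff g1 g2)
    then obtain h1 h2 where "h1 \<in> affine_combinations f" "\<forall>x. (g1 has_real_derivative h1 x) (at x)"
      "h2 \<in> affine_combinations f" "\<forall>x. (g2 has_real_derivative h2 x) (at x)"
      by blast
    then show ?case
      by (intro bexI[of _ "\<lambda>x. h1 x - h2 x"]) (auto intro: affine_combinations.intros DERIV_diff)
  qed
  have "(deriv ^^ k) f \<in> affine_combinations f" for k
  proof (induction k)
    case 0
    show ?case using affine_combinations.base[of f 1 0] by simp
  next
    case (Suc k)
    then obtain h where h: "h \<in> affine_combinations f"
      "\<And>x. ((deriv ^^ k) f has_real_derivative h x) (at x)"
      using deriv by blast
    then have "(deriv ^^ Suc k) f = h"
      by (auto simp: DERIV_imp_deriv)
    with h show ?case by simp
  qed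
  then show ?thesis
    unfolding smooth_def using deriv real_differentiable_def by blast
qed

section \<open>Existence and uniqueness of up, and the transfer to the Fabius function\<close>

lemma ex_rvachev: "\<exists>u. is_rvachev u"
proof -
  obtain f P where f: "symmetric_profile f" and P: "\<And>x. (P has_real_derivative f x) (at x)"
    and eq: "(\<lambda>x. P (2 * x + 1) - P (2 * x - 1)) = f"
    using ex_refinable_profile by blast
  have deriv: "(f has_real_derivative 2 * (f (2 * x + 1) - f (2 * x - 1))) (at x)" for x
    using refine_has_derivative[OF P, of x] unfolding eq .
  have w: "refinement_solution f"
    unfolding refinement_solution_def using deriv symmetric_profile_eq_0[OF f] by blast
  have "f 0 = 1"
    using symmetric_profile_add[OF f, of 0] symmetric_profile_eq_0[OF f, of 1] by simp
  moreover have "{x. f x \<noteq> 0} = {-1<..<1}"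
  proof -
    have "f x \<noteq> 0 \<longleftrightarrow> x \<in> {-1<..<1}" for x
    proof (cases "\<bar>x\<bar> < 1")
      case True
      then show ?thesis
        using symmetric_profile_pos[OF f w True] by auto
    next
      case False
      then show ?thesis
        using symmetric_profile_eq_0[OF f, of x] by auto
    qed
    then show ?thesis by blast
  qed
  ultimately have "is_rvachev f"
    unfolding is_rvachev_def
    by (intro conjI allI deriv refinement_solution_smooth[OF w]) simp_all
  then show ?thesis by blast
qed

text \<open>The support condition gives zeros only strictly outside [-1,1]; the endpoints follow by
  continuity.\<close>

lemma is_rvachev_refinement_solution:
  assumes u: "is_rvachev u"
  shows "refinement_solution u"
proof -
  have deriv: "(u has_real_derivative 2 * (u (2 * x + 1) - u (2 * x - 1))) (at x)" for x
    using u by (simp add: is_rvachev_def)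
  then have "continuous_on UNIV u"
    by (rule DERIV_imp_continuous_on)
  then have closed: "closed {x. u x = 0}"
    by (intro closed_Collect_eq continuous_intros)
  have out: "u x = 0" if "x \<notin> {-1..1}" for x
    using u that closure_subset[of "{x. u x \<noteq> 0}"] by (auto simp: is_rvachev_def)
  have "closure {1<..} \<subseteq> {x. u x = 0}" "closure {..< -1} \<subseteq> {x. u x = 0}"
    using out by (intro closure_minimal closed; auto)+
  then have "u x = 0" if "1 \<le> \<bar>x\<bar>" for x
    using that by (cases "0 \<le> x") (auto simp: closure_greaterThan closure_lessThan subset_iff)
  with deriv show ?thesis by (simp add: refinement_solution_def)
qed

text \<open>The refinement equation is linear, so the difference solves it with value 0 at
  0.\<close>

lemma is_rvachev_unique:
  assumes "is_rvachev u" "is_rvachev v"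
  shows "u = v"
proof
  fix x
  note u = is_rvachev_refinement_solution[OF assms(1)]
  note v = is_rvachev_refinement_solution[OF assms(2)]
  have "((\<lambda>x. u x - v x) has_real_derivative
      2 * ((u (2 * x + 1) - v (2 * x + 1)) - (u (2 * x - 1) - v (2 * x - 1)))) (at x)" for x
    by (rule DERIV_cong[OF DERIV_diff[OF refinement_solution_deriv[OF u] refinement_solution_deriv[OF v]]])
      (simp add: algebra_simps)
  then have "refinement_solution (\<lambda>x. u x - v x)"
    using refinement_solution_eq_0[OF u] refinement_solution_eq_0[OF v]
    by (simp add: refinement_solution_def)
  moreover have "u 0 - v 0 = 0"
    using assms by (simp add: is_rvachev_def)
  ultimately show "u x = v x"
    using refinement_solution_unique[of "\<lambda>x. u x - v x" x] by simp
qed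

lemma is_rvachev_up: "is_rvachev up"
proof -
  have "\<exists>!u. is_rvachev u"
    using ex_rvachev is_rvachev_unique by blast
  then show ?thesis
    unfolding up_def by (rule theI')
qed

lemma fabius_eq_up:
  assumes "0 \<le> x" "x \<le> 2"
  shows "fabius x = up (x - 1)"
proof -
  \<comment> \<open>For positive m the argument is at most -1; equality at x = 2, m = 1 is fine
    because \<open>up\<close> vanishes at -1 too.\<close>
  have "up (x - 2 * real m - 1) = 0" if "m \<noteq> 0" for m
  proof (rule refinement_solution_eq_0[OF is_rvachev_refinement_solution[OF is_rvachev_up]])
    have "1 \<le> real m" using that by simp
    then show "1 \<le> \<bar>x - 2 * real m - 1\<bar>" using assms by linarith
  qed
  then have "fabius x = (\<Sum>m\<in>{0}. (-1) ^ binary_digit_sum m * up (x - 2 * real m - 1))"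
    unfolding fabius_def by (intro suminf_finite) auto
  then show ?thesis
    by (simp add: binary_digit_sum.simps[of 0])
qed

theorem theorem9:
  fixes n :: nat
  assumes "n \<ge> 1"
  shows "2 ^ ((n - 1) choose 2) * fact (2 * n) * fabius (1 / 2 ^ n)
           * (\<Prod>m = 1..n div 2. 2 ^ (2 * m) - 1) \<in> \<nat>"
proof -
  have "(1::real) / 2 ^ n \<le> 1"
    by simp
  then have "fabius (1 / 2 ^ n) = up (1 / 2 ^ n - 1)"
    by (intro fabius_eq_up) (simp, linarith)
  moreover have "up 0 = 1"
    using is_rvachev_up by (simp add: is_rvachev_def)
  ultimately show ?thesis
    using refinement_solution_dyadic_Nats[OF is_rvachev_refinement_solution[OF is_rvachev_up] _ assms]
    by simp
qed

end
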